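(* Let $p\in 4\mathbb{N}=\{4,8,12,\ldots\}$. Then every explicit Runge--Kutta scheme of order $p$ with $s=p$ stages is \emph{not} strongly stable.
   Context: Here $\mathbb{N}=\{1,2,3,\ldots\}$. Consider linear autonomous ODE systems $\frac{du}{dt}=\mathbf{L}u$, $t>0$, $u(0)=u^0\in\mathbb{C}^n$, with $\mathbf{L}\in\mathbb{C}^{n\times n}$. Explicit Runge--Kutta scheme with $s\in\mathbb{N}$ stages, weights $b_i\in\mathbb{C}$ ($1\le i\le s$), coefficients $a_{ij}\in\mathbb{C}$ ($1\le j<i\le s$), and uniform time step $\tau>0$: for $k\ge 1$, $$u^k=u^{k-1}+\tau\sum_{i=1}^s b_iK_i^k,\qquad K_i^k=\mathbf{L}\Big(u^{k-1}+\tau\sum_{j=1}^{i-1}a_{ij}K_j^k\Big),\quad i=1,\ldots,s,$$ where $u^k$ approximates $u(k\tau)$. The scheme can be written as $u^k=R(\tau\mathbf{L})u^{k-1}$, where $R$ is a polynomial of degree at most $s$ depending only on the $b_i,a_{ij}$, called the stability function: $R(z)=1+z\,b^{\top}(I-zA)^{-1}\mathbf{1}$, where $b=(b_1,\dots,b_s)^\top$, $A=(a_{ij})$ is strictly lower triangular, and $\mathbf{1}=(1,\dots,1)^\top$. Order: for the linear systems considered here, the scheme has order $p$ if $s\ge p$ and its stability function has the form $R(z)=\sum_{j=0}^p\frac{z^j}{j!}+\sum_{j=p+1}^s c_j\frac{z^j}{j!}$ with constants $c_{p+1},\ldots,c_s\in\mathbb{C}$, $c_{p+1}\ne 1$. In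 particular, for $s=p$ stages, order $p$ means that $R(z)=\sum_{j=0}^p\frac{z^j}{j!}$. Lyapunov stability: $\mathbf{L}\in\mathbb{C}^{n\times n}$ is Lyapunov stable if all its eigenvalues have nonpositive real part and the purely imaginary eigenvalues (including $0$) are non-defective. For a positive definite Hermitian matrix $\mathbf{P}$, set $\|v\|_{\mathbf{P}}:=\sqrt{\langle v,\mathbf{P}v\rangle}$ for $v\in\mathbb{C}^n$. Strong stability: the Runge--Kutta scheme is strongly stable if for all dimensions $n\in\mathbb{N}$, all Lyapunov stable matrices $\mathbf{L}\in\mathbb{C}^{n\times n}$, and all positive definite Hermitian matrices $\mathbf{P}\in\mathbb{C}^{n\times n}$ with $\mathbf{L}^*\mathbf{P}+\mathbf{P}\mathbf{L}\le 0$ (negative semi-definite), the numerical solution satisfies $\|u^1\|_{\mathbf{P}}\le\|u^0\|_{\mathbf{P}}$ for all initial data $u^0\in\mathbb{C}^n$ and all sufficiently small time steps, i.e., there is $\varepsilon>0$ (which may depend on the scheme, $n$, $\mathbf{L}$ and $\mathbf{P}$, but not on $u^0$) such that $\|R(\tau\mathbf{L})u^0\|_{\mathbf{P}}\le\|u^0\|_{\mathbf{P}}$ for all $\tau\in(0,\varepsilon)$ and all $u^0\in\mathbb{C}^n$. *)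

theory Defs
  imports
    Complex_Main
    "Jordan_Normal_Form.Gauss_Jordan_Elimination"
    "Jordan_Normal_Form.Char_Poly"
    "Jordan_Normal_Form.Matrix_Kernel"
    "Jordan_Normal_Form.Schur_Decomposition"
begin

text \<open>
  An explicit Runge--Kutta scheme is given by its weights \<open>b\<close> and its strictly lower triangular
  coefficient matrix \<open>A\<close>; the number of stages is \<open>dim_vec b\<close>. Stages are numbered from 0.
\<close>

definition explicit_rk :: "nat \<Rightarrow> complex vec \<Rightarrow> complex mat \<Rightarrow> bool" where
  "explicit_rk s b A \<longleftrightarrow> 1 \<le> s \<and> b \<in> carrier_vec s \<and> A \<in> carrier_mat s s
     \<and> (\<forall>i<s. \<forall>j<s. i \<le> j \<longrightarrow> A $$ (i, j) = 0)"

text \<open>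
  The linear combination of the previous stages is written componentwise; \<open>l\<close> is the component.
\<close>

fun rk_stage :: "complex mat \<Rightarrow> complex mat \<Rightarrow> real \<Rightarrow> complex vec \<Rightarrow> nat \<Rightarrow> complex vec" where
  "rk_stage A L \<tau> u i =
     L *\<^sub>v (u + complex_of_real \<tau> \<cdot>\<^sub>v
              vec (dim_vec u) (\<lambda>l. \<Sum>j<i. A $$ (i, j) * rk_stage A L \<tau> u j $ l))"

declare rk_stage.simps [simp del]

definition rk_step ::
  "complex vec \<Rightarrow> complex mat \<Rightarrow> complex mat \<Rightarrow> real \<Rightarrow> complex vec \<Rightarrow> complex vec" where
  "rk_step b A L \<tau> u =
     u + complex_of_real \<tau> \<cdot>\<^sub>v
           vec (dim_vec u) (\<lambda>l. \<Sum>i<dim_vec b. b $ i * rk_stage A L \<tau> u i $ l)"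

text \<open>
  \<open>1 - zA\<close> is unit lower triangular for an explicit scheme, so \<open>mat_inverse\<close> never returns
  \<open>None\<close> here.
\<close>

definition stability_function :: "complex vec \<Rightarrow> complex mat \<Rightarrow> complex \<Rightarrow> complex" where
  "stability_function b A z =
     1 + z * (b \<bullet> (the (mat_inverse (1\<^sub>m (dim_vec b) - z \<cdot>\<^sub>m A)) *\<^sub>v vec (dim_vec b) (\<lambda>_. 1)))"

text \<open>
  Order for linear autonomous systems. For \<open>dim_vec b = p\<close> there is no coefficient \<open>c (p + 1)\<close>.
\<close>

definition rk_order :: "complex vec \<Rightarrow> complex mat \<Rightarrow> nat \<Rightarrow> bool" where
  "rk_order b A p \<longleftrightarrow> p \<le> dim_vec b \<and>
     (\<exists>c :: nat \<Rightarrow> complex.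
        (\<forall>z. stability_function b A z =
               (\<Sum>j\<le>p. z ^ j / fact j) + (\<Sum>j\<in>{p+1..dim_vec b}. c j * z ^ j / fact j)) \<and>
        (p < dim_vec b \<longrightarrow> c (p + 1) \<noteq> 1))"

text \<open>
  An eigenvalue is non-defective if its algebraic and geometric multiplicities coincide;
  \<open>char_matrix L e\<close> is \<open>L - e I\<close>.
\<close>

definition nondefective :: "complex mat \<Rightarrow> complex \<Rightarrow> bool" where
  "nondefective L e \<longleftrightarrow> Polynomial.order e (char_poly L) = kernel_dim (char_matrix L e)"

definition lyapunov_stable :: "complex mat \<Rightarrow> bool" where
  "lyapunov_stable L \<longleftrightarrow>
     (\<forall>e. eigenvalue L e \<longrightarrow> Re e \<le> 0 \<and> (Re e = 0 \<longrightarrow> nondefective L e))"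

definition hermitian_mat :: "complex mat \<Rightarrow> bool" where
  "hermitian_mat P \<longleftrightarrow> P \<in> carrier_mat (dim_row P) (dim_row P) \<and> mat_adjoint P = P"

text \<open>
  For Hermitian \<open>P\<close> the form \<open>(P *\<^sub>v v) \<bullet>c v\<close> is real, so taking \<open>Re\<close> loses nothing.
\<close>

definition pos_def_hermitian :: "complex mat \<Rightarrow> bool" where
  "pos_def_hermitian P \<longleftrightarrow> hermitian_mat P \<and>
     (\<forall>v \<in> carrier_vec (dim_row P). v \<noteq> 0\<^sub>v (dim_row P) \<longrightarrow> 0 < Re ((P *\<^sub>v v) \<bullet>c v))"

definition neg_semidef_hermitian :: "complex mat \<Rightarrow> bool" where
  "neg_semidef_hermitian Q \<longleftrightarrow> hermitian_mat Q \<and>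
     (\<forall>v \<in> carrier_vec (dim_row Q). Re ((Q *\<^sub>v v) \<bullet>c v) \<le> 0)"

definition weighted_norm :: "complex mat \<Rightarrow> complex vec \<Rightarrow> real" where
  "weighted_norm P v = sqrt (Re ((P *\<^sub>v v) \<bullet>c v))"

definition strongly_stable :: "complex vec \<Rightarrow> complex mat \<Rightarrow> bool" where
  "strongly_stable b A \<longleftrightarrow>
     (\<forall>n\<ge>1. \<forall>L \<in> carrier_mat n n. \<forall>P \<in> carrier_mat n n.
        lyapunov_stable L \<longrightarrow> pos_def_hermitian P \<longrightarrow>
        neg_semidef_hermitian (mat_adjoint L * P + P * L) \<longrightarrow>
        (\<exists>\<epsilon>>0. \<forall>\<tau>. 0 < \<tau> \<and> \<tau> < \<epsilon> \<longrightarrow>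
           (\<forall>u0 \<in> carrier_vec n. weighted_norm P (rk_step b A L \<tau> u0) \<le> weighted_norm P u0)))"

end

theory Submission
  imports "HOL-Analysis.Gamma_Function" Defs
begin

text \<open>
  Let \<open>p = 2 m\<close> with \<open>m\<close> even. A single dissipative matrix, with \<open>P\<close> the identity, defeats every
  scheme: the tridiagonal \<open>L\<close> of size \<open>m + 1\<close> with ones above the diagonal, minus ones below
  it, and the only other nonzero entry \<open>-1/2\<close> in the top left corner. Then
  \<open>L\<^sup>* + L = - e\<^sub>0 e\<^sub>0\<^sup>*\<close>: energy leaves the chain only through component \<open>0\<close>, and it takes \<open>m\<close>
  applications of \<open>L\<close> to get there from the far end, so data placed at the far end lose energy
  only at order \<open>2 m + 1\<close> in time.

  A \<open>p\<close>-stage scheme of order \<open>p\<close> maps \<open>u\<close> to the Taylor polynomial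
  \<open>r(\<tau>) = \<Sum>\<^sub>j\<^sub>\<le>\<^sub>p (\<tau> L)\<^sup>j u / j!\<close> (lemmas \<open>stability_coeff_of_order\<close> and \<open>rk_step_eq_polynomial\<close>).
  Since \<open>r' = L r - t\<^sup>p L\<^sup>p\<^sup>+\<^sup>1 u / p!\<close>, the energy changes over a step by
  \<open>- \<integral> r\<^sub>0(t)\<^sup>2 dt - \<integral> 2 t\<^sup>p / p! \<langle>r(t), L\<^sup>p\<^sup>+\<^sup>1 u\<rangle> dt\<close>, both integrals over \<open>[0, \<tau>]\<close>.
  The first term is the dissipation, the second stems from the truncation. Take initial data
  \<open>u\<^sub>i = \<tau>\<^sup>m\<^sup>-\<^sup>i v\<^sub>i\<close> concentrated at the far end. Both terms are then of size \<open>\<tau>\<^sup>p\<^sup>+\<^sup>1\<close>, and their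
  leading coefficients add up to
  \<open>- \<integral> q(s)\<^sup>2 ds + (-1)\<^sup>m v\<^sub>m\<^sup>2 / (2m + 1)!\<close> over \<open>[0, 1]\<close>, with \<open>q(s) = \<Sum>\<^sub>k v\<^sub>k s\<^sup>k / k!\<close>
  (lemma \<open>energy_rate_limit\<close>). For even \<open>m\<close> the truncation error feeds energy in.

  The \<open>v\<^sub>k\<close> are free, so \<open>q\<close> may be any polynomial of degree \<open>m\<close>. The choice
  \<open>q = (s (1 - s))\<^sup>m\<^sup>/\<^sup>2\<close> makes the two terms cancel exactly, because both are the Beta integral
  \<open>m!\<^sup>2 / (2m + 1)!\<close>. Subtracting from this \<open>q\<close> its mean value \<open>\<epsilon>\<close> lowers \<open>\<integral> q\<^sup>2\<close> by
  \<open>\<epsilon>\<^sup>2\<close> and keeps the leading coefficient, so the energy grows for every small step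
  (lemma \<open>energy_growth\<close>).
\<close>

section \<open>The chain operator and its energy balance\<close>

text \<open>
  For \<open>h = 1\<close> this is multiplication by the matrix \<open>L\<close> of the introduction. For general \<open>h\<close>
  it is \<open>D\<^sup>-\<^sup>1 (h L) D\<close> with \<open>D = diag(h\<^sup>m\<^sup>-\<^sup>i)\<close>: in these coordinates one step of size \<open>h\<close> becomes
  a step of size \<open>1\<close>, and the limit \<open>h = 0\<close> is a pure shift. Vectors are functions on the
  naturals of which only the components \<open>0, \<dots>, m\<close> matter.
\<close>

definition chain_op :: "nat \<Rightarrow> real \<Rightarrow> (nat \<Rightarrow> real) \<Rightarrow> nat \<Rightarrow> real" where
  "chain_op m h x i = (if i = 0 then - (h / 2) * x 0 else - h\<^sup>2 * x (i - 1))
                      + (if i < m then x (Suc i) else 0)"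

text \<open>
  The couplings between neighbours are antisymmetric with respect to the rescaled inner product,
  so they cancel in pairs and only the damping at component \<open>0\<close> remains.
\<close>

lemma chain_op_polar_energy:
  "(\<Sum>i\<le>m. h ^ (2 * (m - i)) * (x i * chain_op m h y i + y i * chain_op m h x i))
     = - (h ^ (2 * m + 1) * (x 0 * y 0))"
proof -
  define c where "c i = h ^ (2 * (m - i)) * (x i * y (Suc i) + y i * x (Suc i))" for i
  have up: "(\<Sum>i\<le>m. h ^ (2 * (m - i)) * (if i < m then x i * y (Suc i) + y i * x (Suc i) else 0))
        = (\<Sum>i<m. c i)"
    unfolding c_def by (intro sum.mono_neutral_cong_right) auto
  have down: "(\<Sum>i\<le>m. h ^ (2 * (m - i)) * (if i = 0 then - h * (x 0 * y 0)
          else - h\<^sup>2 * (x i * y (i - 1) + y i * x (i - 1))))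
        = - (h ^ (2 * m + 1) * (x 0 * y 0)) - (\<Sum>i<m. c i)" (is "(\<Sum>i\<le>m. ?f i) = _")
  proof -
    have "(\<Sum>i\<le>m. ?f i) = ?f 0 + (\<Sum>i<m. ?f (Suc i))"
      by (rule sum.atMost_shift)
    also have "(\<Sum>i<m. ?f (Suc i)) = (\<Sum>i<m. - c i)"
    proof (rule sum.cong[OF refl])
      fix i assume "i \<in> {..<m}"
      then have "2 * (m - i) = 2 * (m - Suc i) + 2" by auto
      then have "h ^ (2 * (m - i)) = h ^ (2 * (m - Suc i)) * h\<^sup>2"
        by (metis power_add)
      then show "?f (Suc i) = - c i" by (simp add: c_def algebra_simps)
    qed
    finally show ?thesis by (simp add: sum_negf)
  qed
  have "(\<Sum>i\<le>m. h ^ (2 * (m - i)) * (x i * chain_op m h y i + y i * chain_op m h x i))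
      = (\<Sum>i\<le>m. h ^ (2 * (m - i)) * (if i < m then x i * y (Suc i) + y i * x (Suc i) else 0)
          + h ^ (2 * (m - i)) * (if i = 0 then - h * (x 0 * y 0)
              else - h\<^sup>2 * (x i * y (i - 1) + y i * x (i - 1))))"
    by (rule sum.cong[OF refl]) (auto simp: chain_op_def algebra_simps)
  then show ?thesis unfolding sum.distrib up down by simp
qed

lemma chain_op_sum:
  "chain_op m h (\<lambda>i. \<Sum>j\<in>J. c j * f j i) i = (\<Sum>j\<in>J. c j * chain_op m h (f j) i)"
proof -
  have damp: "\<alpha> * (\<Sum>j\<in>J. c j * f j k) = (\<Sum>j\<in>J. c j * (\<alpha> * f j k))" for \<alpha> k
    unfolding sum_distrib_left by (rule sum.cong[OF refl]) (rule mult.left_commute)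
  have "chain_op m h (\<lambda>i. \<Sum>j\<in>J. c j * f j i) i
      = (\<Sum>j\<in>J. c j * (if i = 0 then - (h / 2) * f j 0 else - h\<^sup>2 * f j (i - 1)))
        + (\<Sum>j\<in>J. c j * (if i < m then f j (Suc i) else 0))"
    unfolding chain_op_def damp by (cases "i = 0"; cases "i < m") simp_all
  also have "\<dots> = (\<Sum>j\<in>J. c j * chain_op m h (f j) i)"
    unfolding chain_op_def distrib_left sum.distrib ..
  finally show ?thesis .
qed

lemma chain_op_rescale:
  assumes "\<And>i. i \<le> m \<Longrightarrow> x i = h ^ (m - i) * y i" and "i \<le> m"
  shows "h * chain_op m 1 x i = h ^ (m - i) * chain_op m h y i"
proof -
  have up: "h * (if i < m then x (Suc i) else 0) = h ^ (m - i) * (if i < m then y (Suc i) else 0)"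
  proof (cases "i < m")
    case True
    then have "m - i = Suc (m - Suc i)" by simp
    then show ?thesis using True assms(1)[of "Suc i"] by simp
  qed simp
  have down: "h * (if i = 0 then - (1/2) * x 0 else - x (i - 1))
      = h ^ (m - i) * (if i = 0 then - (h / 2) * y 0 else - h\<^sup>2 * y (i - 1))"
  proof (cases i)
    case 0
    then show ?thesis using assms(1)[of 0] by simp
  next
    case (Suc k)
    then have "m - k = Suc (m - i)" using assms(2) by simp
    then show ?thesis using Suc assms(2) assms(1)[of k] by (simp add: power2_eq_square)
  qed
  show ?thesis using up down unfolding chain_op_def by (auto simp: algebra_simps)
qed

lemma chain_op_power_rescale:
  assumes "i \<le> m"
  shows "h ^ j * (chain_op m 1 ^^ j) (\<lambda>i. h ^ (m - i) * v i) i
           = h ^ (m - i) * (chain_op m h ^^ j) v i"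
  using assms
proof (induction j arbitrary: i)
  case (Suc j)
  let ?x = "(chain_op m 1 ^^ j) (\<lambda>i. h ^ (m - i) * v i)" and ?y = "(chain_op m h ^^ j) v"
  have lin: "h ^ j * chain_op m 1 ?x i = chain_op m 1 (\<lambda>i. h ^ j * ?x i) i"
    using chain_op_sum[of m 1 "\<lambda>_. h ^ j" "\<lambda>_. ?x" "{()}" i] by simp
  have "h * chain_op m 1 (\<lambda>i. h ^ j * ?x i) i = h ^ (m - i) * chain_op m h ?y i"
    by (rule chain_op_rescale) (use Suc in auto)
  then show ?case by (simp add: lin[symmetric] mult.assoc)
qed simp

lemma chain_op_power_undamped:
  "(chain_op m 0 ^^ j) v i = (if j = 0 then v i else if i + j \<le> m then v (i + j) else 0)"
proof (induction j arbitrary: i)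
  case (Suc j)
  let ?y = "(chain_op m 0 ^^ j) v"
  have "(chain_op m 0 ^^ Suc j) v i = (if i < m then ?y (Suc i) else 0)"
    by (simp add: chain_op_def[of m 0 ?y i])
  then show ?case unfolding Suc by simp
qed simp

text \<open>
  Signals travel at most one site per application, and the leading signal is not attenuated on
  its way down because the superdiagonal entries are \<open>1\<close>.
\<close>

lemma chain_op_power_light_cone:
  "i + j \<le> m \<Longrightarrow>
    (chain_op m 1 ^^ j) (\<lambda>i. if i = m then c else 0) i = (if i + j = m then c else 0)"
proof (induction j arbitrary: i)
  case (Suc j)
  let ?x = "(chain_op m 1 ^^ j) (\<lambda>i. if i = m then c else 0)"
  have up: "?x (Suc i) = (if Suc i + j = m then c else 0)"
    by (rule Suc.IH) (use Suc.prems in linarith)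
  have "?x (i - 1) = (if i - 1 + j = m then c else 0)"
    by (rule Suc.IH) (use Suc.prems in linarith)
  moreover have "i - 1 + j \<noteq> m" using Suc.prems by linarith
  ultimately have down: "?x (i - 1) = 0" by simp
  have "(chain_op m 1 ^^ Suc j) (\<lambda>i. if i = m then c else 0) i = chain_op m 1 ?x i" by simp
  also have "\<dots> = ?x (Suc i)"
  proof -
    have "i < m" using Suc.prems by linarith
    moreover have "?x 0 = 0" if "i = 0" using down that by simp
    ultimately show ?thesis using down by (simp add: chain_op_def[of m 1 ?x i])
  qed
  finally show ?case unfolding up by simp
qed simp

text \<open>
  A closed walk of odd length \<open>2 m + 1\<close> from the far end must use the loop at \<open>0\<close>, which it can
  only just reach. The proof moves powers of \<open>L\<close> from one factor of
  \<open>\<langle>u, L\<^sup>2\<^sup>m\<^sup>+\<^sup>1 u\<rangle>\<close> to the other: by the energy identity each move changes the sign without any loss,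
  as long as the signal has not arrived at \<open>0\<close>. At \<open>\<langle>L\<^sup>m u, L\<^sup>m\<^sup>+\<^sup>1 u\<rangle>\<close> the signal arrives, and
  there the energy identity gives the value.
\<close>

lemma chain_op_power_return:
  "(chain_op m 1 ^^ (2 * m + 1)) (\<lambda>i. if i = m then c else 0) m = (-1) ^ Suc m * c / 2"
proof (cases "c = 0")
  case True
  have "(chain_op m 1 ^^ j) (\<lambda>_. 0) i = 0" for i j
  proof (induction j arbitrary: i)
    case (Suc j)
    then show ?case by (simp add: chain_op_def[of m 1 "(chain_op m 1 ^^ j) (\<lambda>_. 0)" i])
  qed simp
  from this[of "2 * m + 1" m] show ?thesis using True by (simp del: funpow.simps cong: if_cong)
next
  case False
  define x where "x j = (chain_op m 1 ^^ j) (\<lambda>i. if i = m then c else 0)" for j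
  define a where "a j = (\<Sum>i\<le>m. x j i * x (2 * m + 1 - j) i)" for j
  have x_Suc: "x (Suc j) = chain_op m 1 (x j)" for j by (simp add: x_def)
  have polar: "(\<Sum>i\<le>m. x j i * x (Suc k) i) + (\<Sum>i\<le>m. x (Suc j) i * x k i) = - (x j 0 * x k 0)"
    for j k
    using chain_op_polar_energy[where x = "x j" and y = "x k" and h = 1 and m = m]
    by (simp add: x_Suc sum.distrib algebra_simps)
  have "a j + a (Suc j) = - (x j 0 * x (2 * m - j) 0)" if "j \<le> m" for j
    using polar[of j "2 * m - j"] that by (simp add: a_def Suc_diff_le)
  moreover have "x j 0 = (if j = m then c else 0)" if "j \<le> m" for j
    using chain_op_power_light_cone[of 0 j m c] that by (simp add: x_def)
  ultimately have step: "a j + a (Suc j) = (if j = m then - c\<^sup>2 else 0)" if "j \<le> m" for j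
    using that by (simp add: power2_eq_square)
  \<comment> \<open>The two terms of step \<open>m\<close> are the same inner product with its factors exchanged.\<close>
  have "a (Suc m) = a m" by (simp add: a_def mult.commute)
  then have am: "a m = - c\<^sup>2 / 2" using step[of m] by simp
  have "j \<le> m \<Longrightarrow> a 0 = (-1) ^ j * a j" for j
  proof (induction j)
    case (Suc j)
    then have "a (Suc j) = - a j" using step[of j] by simp
    then show ?case using Suc by simp
  qed simp
  from this[of m] am have "a 0 = (-1) ^ Suc m * c\<^sup>2 / 2" by simp
  moreover have "a 0 = c * x (2 * m + 1) m"
    by (simp add: a_def x_def[of 0] if_distrib[where f="\<lambda>t. t * _"] cong: if_cong)
  ultimately have "c * x (2 * m + 1) m = c * ((-1) ^ Suc m * c / 2)"
    by (simp add: power2_eq_square)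
  then show ?thesis unfolding x_def using mult_left_cancel[OF False] by blast
qed

text \<open>
  The numerical solution in the rescaled coordinates, \<open>s\<close> being the fraction of the step that has
  been performed: the exponential series of \<open>s M\<close> applied to \<open>v\<close>, with \<open>M\<close> the rescaled operator, cut off
  at degree \<open>2 m\<close>.
\<close>

definition trunc_exp :: "nat \<Rightarrow> (nat \<Rightarrow> real) \<Rightarrow> real \<Rightarrow> real \<Rightarrow> nat \<Rightarrow> real" where
  "trunc_exp m v h s i = (\<Sum>j\<le>2 * m. s ^ j / fact j * (chain_op m h ^^ j) v i)"

lemma trunc_exp_deriv:
  "((\<lambda>s. trunc_exp m v h s i) has_real_derivative
      chain_op m h (trunc_exp m v h s) i
        - s ^ (2 * m) / fact (2 * m) * (chain_op m h ^^ (2 * m + 1)) v i) (at s)"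
proof -
  let ?p = "2 * m"
  let ?c = "\<lambda>j. (chain_op m h ^^ j) v i"
  have deriv: "((\<lambda>s. \<Sum>j\<le>?p. s ^ j / fact j * ?c j) has_real_derivative
          (\<Sum>j\<le>?p. real j * s ^ (j - 1) / fact j * ?c j)) (at s)"
    by (auto intro!: derivative_eq_intros sum.cong)
  have shift: "(\<Sum>j\<le>?p. real j * s ^ (j - 1) / fact j * ?c j)
      = (\<Sum>j<?p. s ^ j / fact j * ?c (Suc j))"
    unfolding sum.atMost_shift by (auto intro!: sum.cong simp: divide_simps)
  have "chain_op m h (trunc_exp m v h s) i = (\<Sum>j\<le>?p. s ^ j / fact j * ?c (Suc j))"
    unfolding trunc_exp_def[abs_def] chain_op_sum by simp
  also have "\<dots> = (\<Sum>j<?p. s ^ j / fact j * ?c (Suc j)) + s ^ ?p / fact ?p * ?c (Suc ?p)"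
    unfolding lessThan_Suc_atMost[symmetric] by (rule sum.lessThan_Suc)
  finally have apply_chain: "(\<Sum>j<?p. s ^ j / fact j * ?c (Suc j))
      = chain_op m h (trunc_exp m v h s) i - s ^ ?p / fact ?p * ?c (2 * m + 1)"
    by (simp only: Suc_eq_plus1 add_diff_cancel_right')
  show ?thesis using deriv unfolding shift apply_chain trunc_exp_def .
qed

definition energy :: "nat \<Rightarrow> (nat \<Rightarrow> real) \<Rightarrow> real \<Rightarrow> real \<Rightarrow> real" where
  "energy m v h s = (\<Sum>i\<le>m. h ^ (2 * (m - i)) * (trunc_exp m v h s i)\<^sup>2)"

text \<open>
  The derivative of the energy divided by \<open>h\<^sup>2\<^sup>m\<^sup>+\<^sup>1\<close>. The second factor of the inner product is
  written in the original coordinates, where the powers of \<open>h\<close> are visibly nonnegative, so that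
  the formula makes sense and is continuous at \<open>h = 0\<close>.
\<close>

definition energy_rate :: "nat \<Rightarrow> (nat \<Rightarrow> real) \<Rightarrow> real \<Rightarrow> real \<Rightarrow> real" where
  "energy_rate m v h s = - (trunc_exp m v h s 0)\<^sup>2
     - 2 * s ^ (2 * m) / fact (2 * m) * (\<Sum>i\<le>m. h ^ (m - i) * trunc_exp m v h s i *
          (chain_op m 1 ^^ (2 * m + 1)) (\<lambda>i. h ^ (m - i) * v i) i)"

lemma energy_deriv:
  "(energy m v h has_real_derivative h ^ (2 * m + 1) * energy_rate m v h s) (at s)"
proof -
  let ?r = "trunc_exp m v h s"
  let ?C = "\<lambda>i. (chain_op m h ^^ (2 * m + 1)) v i"
  let ?D = "\<lambda>i. (chain_op m 1 ^^ (2 * m + 1)) (\<lambda>i. h ^ (m - i) * v i) i"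
  let ?b = "s ^ (2 * m) / fact (2 * m)"
  have square: "((\<lambda>s. c * (f s)\<^sup>2) has_real_derivative c * (2 * f s * D)) (at s)"
    if "(f has_real_derivative D) (at s)" for f :: "real \<Rightarrow> real" and c D
    using that by (auto intro!: derivative_eq_intros)
  have "(energy m v h has_real_derivative
     (\<Sum>i\<le>m. h ^ (2 * (m - i)) * (2 * ?r i * (chain_op m h ?r i - ?b * ?C i)))) (at s)"
    unfolding energy_def[abs_def]
    by (intro DERIV_sum square trunc_exp_deriv)
  also have "(\<Sum>i\<le>m. h ^ (2 * (m - i)) * (2 * ?r i * (chain_op m h ?r i - ?b * ?C i)))
    = (\<Sum>i\<le>m. h ^ (2 * (m - i)) * (?r i * chain_op m h ?r i + ?r i * chain_op m h ?r i))
      - (\<Sum>i\<le>m. 2 * ?b * (h ^ (m - i) * ?r i * (h ^ (m - i) * ?C i)))"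
    unfolding sum_subtractf[symmetric]
  proof (rule sum.cong[OF refl])
    fix i
    have "w * w * (2 * r * (c - \<beta> * d)) = w * w * (r * c + r * c) - 2 * \<beta> * (w * r * (w * d))"
      for w r c d \<beta> :: real by (simp add: algebra_simps)
    then show "h ^ (2 * (m - i)) * (2 * ?r i * (chain_op m h ?r i - ?b * ?C i))
        = h ^ (2 * (m - i)) * (?r i * chain_op m h ?r i + ?r i * chain_op m h ?r i)
          - 2 * ?b * (h ^ (m - i) * ?r i * (h ^ (m - i) * ?C i))"
      unfolding mult_2[of "m - i"] power_add .
  qed
  also have "(\<Sum>i\<le>m. 2 * ?b * (h ^ (m - i) * ?r i * (h ^ (m - i) * ?C i)))
    = (\<Sum>i\<le>m. 2 * ?b * (h ^ (m - i) * ?r i * (h ^ (2 * m + 1) * ?D i)))"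
  proof (rule sum.cong[OF refl])
    fix i assume "i \<in> {..m}"
    then have "i \<le> m" by simp
    from chain_op_power_rescale[OF this, of h "2 * m + 1" v]
    show "2 * ?b * (h ^ (m - i) * ?r i * (h ^ (m - i) * ?C i))
        = 2 * ?b * (h ^ (m - i) * ?r i * (h ^ (2 * m + 1) * ?D i))"
      by (simp only:)
  qed
  also have "\<dots> = h ^ (2 * m + 1) * (2 * ?b * (\<Sum>i\<le>m. h ^ (m - i) * ?r i * ?D i))"
    by (simp only: sum_distrib_left mult_ac)
  also have "(\<Sum>i\<le>m. h ^ (2 * (m - i)) * (?r i * chain_op m h ?r i + ?r i * chain_op m h ?r i))
      = - (h ^ (2 * m + 1) * (?r 0)\<^sup>2)"
    unfolding chain_op_polar_energy by (simp only: power2_eq_square)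
  finally show ?thesis
    by (simp only: energy_rate_def right_diff_distrib mult_minus_right times_divide_eq_right)
qed

lemma chain_op_power_continuous:
  assumes "\<And>i. continuous_on S (\<lambda>z. x z i)" and "continuous_on S g"
  shows "continuous_on S (\<lambda>z. (chain_op m (g z) ^^ j) (x z) i)"
proof (induction j arbitrary: i)
  case (Suc j)
  have "continuous_on S (\<lambda>z. chain_op m (g z) (y z) i)"
    if "\<And>i. continuous_on S (\<lambda>z. y z i)" for y
  proof -
    have "continuous_on S (\<lambda>z. if i = 0 then - (g z / 2) * y z 0 else - (g z)\<^sup>2 * y z (i - 1))"
      by (cases i) (simp_all add: continuous_on_minus continuous_on_mult continuous_on_power
          continuous_on_divide assms(2) that)
    moreover have "continuous_on S (\<lambda>z. if i < m then y z (Suc i) else 0)"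
      by (cases "i < m") (simp_all add: that)
    ultimately show ?thesis unfolding chain_op_def by (rule continuous_on_add)
  qed
  from this[OF Suc] show ?case by simp
qed (simp add: assms)

lemma energy_rate_continuous:
  "continuous_on UNIV (\<lambda>(h, s). energy_rate m v h s)"
  unfolding energy_rate_def trunc_exp_def case_prod_beta
  by (intro continuous_intros chain_op_power_continuous) auto

text \<open>
  At \<open>h = 0\<close> the operator is a shift, so component \<open>0\<close> of the truncated exponential is the
  polynomial with Taylor coefficients \<open>v\<close>, and of the truncation error only the component at
  the far end survives, which \<open>chain_op_power_return\<close> evaluates.
\<close>

lemma energy_rate_limit:
  "energy_rate m v 0 s = - (\<Sum>j\<le>m. v j / fact j * s ^ j)\<^sup>2
      + (-1) ^ m * (v m)\<^sup>2 / fact (2 * m) * s ^ (2 * m)"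
proof -
  have r: "trunc_exp m v 0 s i = (\<Sum>j\<le>m - i. v (i + j) / fact j * s ^ j)" if "i \<le> m" for i
    unfolding trunc_exp_def chain_op_power_undamped using that
    by (intro sum.mono_neutral_cong_right) auto
  have "(\<Sum>i\<le>m. 0 ^ (m - i) * trunc_exp m v 0 s i *
          (chain_op m 1 ^^ (2 * m + 1)) (\<lambda>i. 0 ^ (m - i) * v i) i)
     = (\<Sum>i\<in>{m}. v m * (chain_op m 1 ^^ (2 * m + 1)) (\<lambda>i. 0 ^ (m - i) * v i) m)"
    by (intro sum.mono_neutral_cong_right) (auto simp: r power_0_left)
  also have "(chain_op m 1 ^^ (2 * m + 1)) (\<lambda>i. 0 ^ (m - i) * v i) m
     = (chain_op m 1 ^^ (2 * m + 1)) (\<lambda>i. if i = m then v m else 0) m"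
  proof -
    have "(chain_op m 1 ^^ j) x i = (chain_op m 1 ^^ j) y i"
      if "\<And>i. i \<le> m \<Longrightarrow> x i = y i" "i \<le> m" for i j x y
      using that(2)
    proof (induction j arbitrary: i)
      case (Suc j)
      have "chain_op m 1 x' i = chain_op m 1 y' i" if "\<And>i. i \<le> m \<Longrightarrow> x' i = y' i" for x' y'
        using that Suc.prems by (simp add: chain_op_def)
      from this[OF Suc.IH] show ?case by simp
    qed (simp add: that(1))
    from this[of "\<lambda>i. 0 ^ (m - i) * v i" "\<lambda>i. if i = m then v m else 0"]
    show ?thesis by (auto simp: power_0_left simp del: funpow.simps)
  qed
  finally show ?thesis
    unfolding energy_rate_def chain_op_power_return by (simp add: r power2_eq_square algebra_simps)
qed

lemma integral_symmetric_beta: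
  assumes "0 < (m::nat)"
  shows "((\<lambda>t::real. (t * (1 - t)) ^ m) has_integral (fact m)\<^sup>2 / fact (2 * m + 1)) {0..1}"
proof -
  have beta: "((\<lambda>t. t powr (real (Suc m) - 1) * (1 - t) powr (real (Suc m) - 1))
          has_integral Beta (real (Suc m)) (real (Suc m))) {0..1}"
    by (rule has_integral_Beta_real) auto
  have val: "Beta (real (Suc m)) (real (Suc m)) = (fact m)\<^sup>2 / fact (2 * m + 1)"
    using Gamma_fact[of m, where ?'a = real] Gamma_fact[of "2 * m + 1", where ?'a = real]
    by (simp add: Beta_def power2_eq_square algebra_simps)
  have eq: "(t powr (real (Suc m) - 1) * (1 - t) powr (real (Suc m) - 1)) = (t * (1 - t)) ^ m"
    if "t \<in> {0..1}" for t :: real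
    using that assms by (simp add: powr_realpow' power_mult_distrib)
  show ?thesis using has_integral_eq[OF eq beta[unfolded val]] .
qed

text \<open>
  The choice of \<open>v\<close> for which \<open>q = (s (1 - s))\<^sup>k - \<epsilon>\<close>, where \<open>\<epsilon>\<close> is the mean value of
  \<open>(s (1 - s))\<^sup>k\<close>. Without \<open>\<epsilon>\<close> the integral of the rate is zero; the value gained is the
  squared mean \<open>\<epsilon>\<^sup>2\<close>.
\<close>

lemma energy_rate_limit_positive_integral:
  assumes m: "m = 2 * k" and k: "0 < k"
  obtains v I where "(energy_rate m v 0 has_integral I) {0..1}" and "0 < I"
proof -
  \<comment> \<open>The mean value of \<open>(s (1 - s))\<^sup>k\<close> on the unit interval.\<close>
  define \<epsilon> :: real where "\<epsilon> = (fact k)\<^sup>2 / fact (2 * k + 1)"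
  have \<epsilon>: "((\<lambda>t. (t * (1 - t)) ^ k) has_integral \<epsilon>) {0..1}" "0 < \<epsilon>"
    using integral_symmetric_beta[OF k] by (auto simp: \<epsilon>_def)
  define q :: "real poly" where "q = [:0, 1, -1:] ^ k - [:\<epsilon>:]"
  define v where "v j = fact j * coeff q j" for j
  have deg: "degree ([:0, 1, -1 :: real:] ^ k) = m" by (simp add: degree_power_eq m)
  have "degree q \<le> m"
    unfolding q_def by (rule degree_diff_le) (simp_all add: deg)
  then have vq: "(\<Sum>j\<le>m. v j / fact j * s ^ j) = poly q s" for s
    unfolding poly_altdef v_def
    by (intro sum.mono_neutral_cong_right) (auto simp: coeff_eq_0)
  have "coeff q m = lead_coeff ([:0, 1, -1 :: real:] ^ k)"
    using k by (simp add: q_def deg m coeff_pCons split: nat.split)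
  also have "\<dots> = (-1) ^ k" unfolding lead_coeff_power by simp
  finally have vm: "(v m)\<^sup>2 = (fact m)\<^sup>2"
    by (simp add: v_def power_mult_distrib flip: power_mult)
  have rate: "energy_rate m v 0 s = - ((s * (1 - s)) ^ m - 2 * \<epsilon> * (s * (1 - s)) ^ k + \<epsilon>\<^sup>2)
      + (fact m)\<^sup>2 / fact (2 * m) * s ^ (2 * m)" for s
  proof -
    have "poly q s = (s * (1 - s)) ^ k - \<epsilon>" by (simp add: q_def algebra_simps)
    moreover have "(s * (1 - s)) ^ m = ((s * (1 - s)) ^ k)\<^sup>2"
      by (simp only: m mult.commute[of 2 k] power_mult)
    ultimately have "(poly q s)\<^sup>2 = (s * (1 - s)) ^ m - 2 * \<epsilon> * (s * (1 - s)) ^ k + \<epsilon>\<^sup>2"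
      by (simp only: power2_diff mult_ac)
    then show ?thesis unfolding energy_rate_limit vq vm by (simp add: m)
  qed
  have mono: "((\<lambda>s::real. s ^ (2 * m)) has_integral 1 / (2 * m + 1)) {0..1}"
  proof -
    have "((\<lambda>s::real. s ^ Suc (2 * m) / real (Suc (2 * m))) has_vector_derivative s ^ (2 * m))
        (at s within {0..1})" for s
      unfolding has_real_derivative_iff_has_vector_derivative[symmetric]
      by (rule DERIV_cong[OF DERIV_cdivide[OF DERIV_pow]]) (simp del: of_nat_Suc)
    then have "((\<lambda>s::real. s ^ (2 * m)) has_integral
        1 ^ Suc (2 * m) / real (Suc (2 * m)) - 0 ^ Suc (2 * m) / real (Suc (2 * m))) {0..1}"
      by (intro fundamental_theorem_of_calculus) simp
    then show ?thesis by (simp add: add.commute)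
  qed
  have const: "((\<lambda>s::real. \<epsilon>\<^sup>2) has_integral \<epsilon>\<^sup>2) {0..1}"
    using has_integral_const_real[of "\<epsilon>\<^sup>2" 0 1] by simp
  have "0 < m" using m k by simp
  have "(energy_rate m v 0 has_integral
      - ((fact m)\<^sup>2 / fact (2 * m + 1) - 2 * \<epsilon> * \<epsilon> + \<epsilon>\<^sup>2)
      + (fact m)\<^sup>2 / fact (2 * m) * (1 / (2 * m + 1))) {0..1}"
    unfolding rate
    by (intro has_integral_add has_integral_neg has_integral_diff has_integral_mult_right
        integral_symmetric_beta[OF \<open>0 < m\<close>] \<epsilon>(1) mono const)
  also have "- ((fact m)\<^sup>2 / fact (2 * m + 1) - 2 * \<epsilon> * \<epsilon> + \<epsilon>\<^sup>2)
      + (fact m)\<^sup>2 / fact (2 * m) * (1 / (2 * m + 1)) = \<epsilon>\<^sup>2"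
    by (simp add: power2_eq_square mult.commute)
  finally show ?thesis using that \<epsilon>(2) by auto
qed

text \<open>
  The energy gained over a step is \<open>h\<^sup>2\<^sup>m\<^sup>+\<^sup>1\<close> times the integral of the rate. This integral
  depends continuously on \<open>h\<close> and is positive at \<open>h = 0\<close>, hence also for small \<open>h\<close>.
\<close>

lemma energy_growth:
  assumes "m = 2 * k" and "0 < k"
  obtains v \<delta> where "0 < \<delta>" and "\<And>h. 0 < h \<Longrightarrow> h < \<delta> \<Longrightarrow> energy m v h 0 < energy m v h 1"
proof -
  obtain v I where I: "(energy_rate m v 0 has_integral I) {0..1}" "0 < I"
    using energy_rate_limit_positive_integral[OF assms] by blast
  define J where "J h = integral {0..1} (energy_rate m v h)" for h
  have "continuous_on UNIV J"
    unfolding J_def box_real(2)[symmetric]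
    by (rule integral_continuous_on_param)
      (rule continuous_on_subset[OF energy_rate_continuous], simp)
  moreover have "J 0 > 0" using I by (simp add: J_def integral_unique)
  ultimately have "\<forall>\<^sub>F h in nhds 0. J h > 0"
    by (intro order_tendstoD)
      (auto simp: continuous_on_eq_continuous_at isCont_def tendsto_at_iff_tendsto_nhds)
  then obtain \<delta> where \<delta>: "0 < \<delta>" "\<And>h. dist h 0 < \<delta> \<Longrightarrow> J h > 0"
    unfolding eventually_nhds_metric by blast
  have "energy m v h 0 < energy m v h 1" if "0 < h" "h < \<delta>" for h
  proof -
    have "(energy m v h has_vector_derivative h ^ (2 * m + 1) * energy_rate m v h s)
        (at s within {0..1})" for s
      using has_field_derivative_at_within[OF energy_deriv]
      unfolding has_real_derivative_iff_has_vector_derivative .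
    then have "((\<lambda>s. h ^ (2 * m + 1) * energy_rate m v h s) has_integral
        energy m v h 1 - energy m v h 0) {0..1}"
      by (intro fundamental_theorem_of_calculus) simp
    moreover have "continuous_on {0..1} (\<lambda>s. case (h, s) of (h, s) \<Rightarrow> energy_rate m v h s)"
      by (rule continuous_on_compose2[OF energy_rate_continuous]) (auto intro!: continuous_intros)
    then have "continuous_on {0..1} (energy_rate m v h)" by simp
    then have "((\<lambda>s. h ^ (2 * m + 1) * energy_rate m v h s) has_integral
        h ^ (2 * m + 1) * J h) {0..1}"
      unfolding J_def
      by (intro has_integral_mult_right integrable_integral integrable_continuous_real)
    ultimately have "energy m v h 1 - energy m v h 0 = h ^ (2 * m + 1) * J h"
      by (rule has_integral_unique)
    also have "\<dots> > 0" using that \<delta> by simp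
    finally show ?thesis by simp
  qed
  then show ?thesis using that \<delta>(1) by blast
qed

section \<open>The Runge--Kutta step as a polynomial in the matrix\<close>

text \<open>
  Component \<open>i\<close> of \<open>A\<^sup>r 1\<close> for strictly lower triangular \<open>A\<close>, where \<open>1\<close> is the all-ones vector.
  Stage \<open>i\<close> is \<open>\<Sum>\<^sub>r \<tau>\<^sup>r (A\<^sup>r 1)\<^sub>i L\<^sup>r\<^sup>+\<^sup>1 u\<close>.
\<close>

fun elementary_weight :: "complex mat \<Rightarrow> nat \<Rightarrow> nat \<Rightarrow> complex" where
  "elementary_weight A 0 i = 1"
| "elementary_weight A (Suc r) i = (\<Sum>j<i. A $$ (i, j) * elementary_weight A r j)"

lemma elementary_weight_eq_0: "i < r \<Longrightarrow> elementary_weight A r i = 0"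
proof (induction r arbitrary: i)
  case (Suc r)
  then show ?case by (auto intro!: sum.neutral)
qed simp

definition stability_coeff :: "complex vec \<Rightarrow> complex mat \<Rightarrow> nat \<Rightarrow> complex" where
  "stability_coeff b A j =
     (case j of 0 \<Rightarrow> 1 | Suc r \<Rightarrow> \<Sum>i<dim_vec b. b $ i * elementary_weight A r i)"

text \<open>
  Because \<open>A\<close> is nilpotent, \<open>(1 - z A)\<^sup>-\<^sup>1 1\<close> is the finite Neumann sum \<open>\<Sum>\<^sub>r z\<^sup>r A\<^sup>r 1\<close>.
\<close>

lemma stability_function_eq_polynomial:
  assumes "explicit_rk s b A"
  shows "stability_function b A z = (\<Sum>j\<le>s. stability_coeff b A j * z ^ j)"
proof -
  from assms have b: "b \<in> carrier_vec s" and A: "A \<in> carrier_mat s s"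
    and A0: "\<And>i j. i < s \<Longrightarrow> j < s \<Longrightarrow> i \<le> j \<Longrightarrow> A $$ (i, j) = 0"
    unfolding explicit_rk_def by auto
  define M where "M = 1\<^sub>m s - z \<cdot>\<^sub>m A"
  define \<kappa> where "\<kappa> = vec s (\<lambda>i. \<Sum>r<s. z ^ r * elementary_weight A r i)"
  have M: "M \<in> carrier_mat s s" unfolding M_def by (rule minus_carrier_mat) (use A in simp)
  \<comment> \<open>\<open>M\<close> is unit lower triangular, so the inverse in the stability function exists.\<close>
  have "det M = prod_list (diag_mat M)"
    by (rule det_lower_triangular[OF _ M]) (use A A0 in \<open>auto simp: M_def\<close>)
  also have "\<dots> = (\<Prod>i<s. 1)"
    using A A0 by (auto simp: prod_list_diag_prod M_def lessThan_atLeast0 intro!: prod.cong)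
  finally have "M \<in> Units (ring_mat TYPE(complex) s ())"
    using det_non_zero_imp_unit[OF M, of "()"] by simp
  then obtain B where B: "mat_inverse M = Some B"
    using mat_inverse(1)[OF M, where b = "()"] by (cases "mat_inverse M") auto
  from mat_inverse(2)[OF M B] have BM: "B * M = 1\<^sub>m s" and Bc: "B \<in> carrier_mat s s" by auto
  have "M *\<^sub>v \<kappa> = vec s (\<lambda>_. 1)"
  proof (rule eq_vecI)
    fix i assume "i < dim_vec (vec s (\<lambda>_. 1 :: complex))"
    then have i: "i < s" by simp
    define w where "w r = elementary_weight A r i" for r
    define f where "f j = (\<Sum>r<s. z ^ r * elementary_weight A r j)" for j
    have "(\<Sum>j<s. A $$ (i, j) * elementary_weight A r j) = w (Suc r)" for r
      unfolding w_def elementary_weight.simps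
      by (rule sum.mono_neutral_right) (use i A0 in auto)
    then have A_f: "(\<Sum>j<s. A $$ (i, j) * f j) = (\<Sum>r<s. z ^ r * w (Suc r))"
      unfolding f_def sum_distrib_left
      by (subst sum.swap) (simp add: sum_distrib_left[symmetric] mult.left_commute)
    have "(M *\<^sub>v \<kappa>) $ i = (\<Sum>j<s. ((if i = j then 1 else 0) - z * A $$ (i, j)) * f j)"
      using i A M by (simp add: M_def \<kappa>_def f_def scalar_prod_def lessThan_atLeast0)
    also have "\<dots> = f i - z * (\<Sum>j<s. A $$ (i, j) * f j)"
      using i by (simp add: left_diff_distrib sum_subtractf sum_distrib_left mult.assoc
          if_distrib[where f="\<lambda>t. t * _"] cong: if_cong)
    also have "\<dots> = (\<Sum>r<s. z ^ r * w r - z ^ Suc r * w (Suc r))"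
      unfolding A_f by (simp add: f_def w_def sum_subtractf sum_distrib_left mult.assoc)
    also have "\<dots> = w 0 - z ^ s * w s"
      by (subst sum_lessThan_telescope') simp
    also have "\<dots> = 1" using i by (simp add: w_def elementary_weight_eq_0)
    finally show "(M *\<^sub>v \<kappa>) $ i = vec s (\<lambda>_. 1) $ i" using i by simp
  qed (use M in simp)
  moreover have "B *\<^sub>v (M *\<^sub>v \<kappa>) = \<kappa>"
    using BM Bc M by (simp add: \<kappa>_def flip: assoc_mult_mat_vec)
  ultimately have "the (mat_inverse M) *\<^sub>v vec s (\<lambda>_. 1) = \<kappa>" by (simp add: B)
  then have "stability_function b A z = 1 + z * (b \<bullet> \<kappa>)"
    using b by (simp add: stability_function_def M_def)
  also have "b \<bullet> \<kappa> = (\<Sum>r<s. z ^ r * stability_coeff b A (Suc r))"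
    using b by (simp add: scalar_prod_def \<kappa>_def stability_coeff_def sum_distrib_left
        lessThan_atLeast0 mult.left_commute) (rule sum.swap)
  also have "1 + z * \<dots> = (\<Sum>j\<le>s. stability_coeff b A j * z ^ j)"
    unfolding sum.atMost_shift by (simp add: stability_coeff_def[of _ _ 0] sum_distrib_left mult_ac)
  finally show ?thesis .
qed

text \<open>
  The order condition prescribes the stability function pointwise; a polynomial function
  determines its coefficients.
\<close>

lemma stability_coeff_of_order:
  assumes "explicit_rk s b A" and "rk_order b A s" and "j \<le> s"
  shows "stability_coeff b A j = 1 / fact j"
proof -
  have "dim_vec b = s" using assms(1) by (auto simp: explicit_rk_def)
  then have "stability_function b A z = (\<Sum>j\<le>s. 1 / fact j * z ^ j)" for z
    using assms(2) by (auto simp: rk_order_def)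
  then have "\<forall>z. (\<Sum>j\<le>s. stability_coeff b A j * z ^ j) = (\<Sum>j\<le>s. 1 / fact j * z ^ j)"
    using stability_function_eq_polynomial[OF assms(1)] by simp
  then show ?thesis unfolding polyfun_eq_coeffs using assms(3) by simp
qed

lemma mult_mat_vec_sum:
  fixes L :: "complex mat"
  assumes "L \<in> carrier_mat n n" and "\<And>r. r \<in> R \<Longrightarrow> y r \<in> carrier_vec n" and "l < n"
  shows "(L *\<^sub>v vec n (\<lambda>l. \<Sum>r\<in>R. c r * y r $ l)) $ l = (\<Sum>r\<in>R. c r * (L *\<^sub>v y r) $ l)"
proof -
  have "(L *\<^sub>v vec n (\<lambda>l. \<Sum>r\<in>R. c r * y r $ l)) $ l
      = (\<Sum>k<n. \<Sum>r\<in>R. c r * (L $$ (l, k) * y r $ k))"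
    using assms
    by (simp add: scalar_prod_def sum_distrib_left lessThan_atLeast0)
      (intro sum.cong refl, simp add: mult.left_commute)
  also have "\<dots> = (\<Sum>r\<in>R. \<Sum>k<n. c r * (L $$ (l, k) * y r $ k))" by (rule sum.swap)
  also have "\<dots> = (\<Sum>r\<in>R. c r * (L *\<^sub>v y r) $ l)"
  proof (rule sum.cong[OF refl])
    fix r assume "r \<in> R"
    then show "(\<Sum>k<n. c r * (L $$ (l, k) * y r $ k)) = c r * (L *\<^sub>v y r) $ l"
      using assms(1,3) assms(2)[of r]
      by (auto simp: scalar_prod_def sum_distrib_left lessThan_atLeast0 intro!: sum.cong)
  qed
  finally show ?thesis .
qed

lemma rk_stage_eq_polynomial:
  assumes L: "L \<in> carrier_mat n n" and u: "u \<in> carrier_vec n" and "i < s" and "l < n"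
  shows "rk_stage A L \<tau> u i $ l
      = (\<Sum>r<s. of_real \<tau> ^ r * elementary_weight A r i * (((*\<^sub>v) L) ^^ Suc r) u $ l)"
  using assms(3,4)
proof (induction i arbitrary: l rule: less_induct)
  case (less i)
  define y where "y r = (((*\<^sub>v) L) ^^ r) u" for r
  have y: "y r \<in> carrier_vec n" for r
    unfolding y_def by (induction r) (use L u in auto)
  define t where "t = complex_of_real \<tau>"
  define w where "w r = elementary_weight A r" for r
  have stage_arg: "u + t \<cdot>\<^sub>v vec (dim_vec u) (\<lambda>l. \<Sum>j<i. A $$ (i, j) * rk_stage A L \<tau> u j $ l)
      = vec n (\<lambda>l. \<Sum>r<s. t ^ r * w r i * y r $ l)"
  proof (rule eq_vecI)
    fix l assume "l < dim_vec (vec n (\<lambda>l. \<Sum>r<s. t ^ r * w r i * y r $ l))"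
    then have l: "l < n" by simp
    have "(\<Sum>j<i. A $$ (i, j) * rk_stage A L \<tau> u j $ l)
        = (\<Sum>j<i. \<Sum>r<s. t ^ r * y (Suc r) $ l * (A $$ (i, j) * w r j))"
    proof (rule sum.cong[OF refl])
      fix j assume "j \<in> {..<i}"
      then have "rk_stage A L \<tau> u j $ l = (\<Sum>r<s. t ^ r * w r j * y (Suc r) $ l)"
        using less.IH[of j l] less.prems l unfolding t_def w_def y_def by simp
      then show "A $$ (i, j) * rk_stage A L \<tau> u j $ l
          = (\<Sum>r<s. t ^ r * y (Suc r) $ l * (A $$ (i, j) * w r j))"
        by (simp add: sum_distrib_left mult_ac)
    qed
    also have "\<dots> = (\<Sum>r<s. \<Sum>j<i. t ^ r * y (Suc r) $ l * (A $$ (i, j) * w r j))"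
      by (rule sum.swap)
    also have "\<dots> = (\<Sum>r<s. t ^ r * w (Suc r) i * y (Suc r) $ l)"
      unfolding w_def elementary_weight.simps by (simp add: sum_distrib_left sum_distrib_right mult_ac)
    finally have sumK: "t * (\<Sum>j<i. A $$ (i, j) * rk_stage A L \<tau> u j $ l)
        = (\<Sum>r<s. t ^ Suc r * w (Suc r) i * y (Suc r) $ l)"
      by (simp add: sum_distrib_left mult.assoc)
    \<comment> \<open>The added term vanishes because \<open>i < s\<close>; it makes room for the index shift.\<close>
    have "(\<Sum>r<s. t ^ r * w r i * y r $ l) = (\<Sum>r\<le>s. t ^ r * w r i * y r $ l)"
      using less.prems by (simp add: lessThan_Suc_atMost[symmetric] w_def elementary_weight_eq_0)
    also have "\<dots> = u $ l + (\<Sum>r<s. t ^ Suc r * w (Suc r) i * y (Suc r) $ l)"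
      unfolding sum.atMost_shift by (simp add: w_def y_def)
    finally show "(u + t \<cdot>\<^sub>v vec (dim_vec u) (\<lambda>l. \<Sum>j<i. A $$ (i, j) * rk_stage A L \<tau> u j $ l)) $ l
        = vec n (\<lambda>l. \<Sum>r<s. t ^ r * w r i * y r $ l) $ l"
      using l u sumK by simp
  qed (use u in simp)
  have "rk_stage A L \<tau> u i $ l = (L *\<^sub>v vec n (\<lambda>l. \<Sum>r<s. (t ^ r * w r i) * y r $ l)) $ l"
    unfolding rk_stage.simps[of A L \<tau> u i] t_def[symmetric] stage_arg ..
  also have "\<dots> = (\<Sum>r<s. t ^ r * w r i * (L *\<^sub>v y r) $ l)"
    by (rule mult_mat_vec_sum[OF L]) (use y less.prems in auto)
  finally show ?case by (simp add: t_def w_def y_def)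
qed

lemma rk_step_eq_polynomial:
  assumes "explicit_rk s b A" and L: "L \<in> carrier_mat n n" and u: "u \<in> carrier_vec n" and l: "l < n"
  shows "rk_step b A L \<tau> u $ l
      = (\<Sum>j\<le>s. stability_coeff b A j * of_real \<tau> ^ j * (((*\<^sub>v) L) ^^ j) u $ l)"
proof -
  define y where "y r = (((*\<^sub>v) L) ^^ r) u" for r
  define t where "t = complex_of_real \<tau>"
  have b: "dim_vec b = s" using assms(1) by (auto simp: explicit_rk_def)
  have "(\<Sum>i<s. b $ i * rk_stage A L \<tau> u i $ l)
      = (\<Sum>i<s. \<Sum>r<s. t ^ r * y (Suc r) $ l * (b $ i * elementary_weight A r i))"
    by (rule sum.cong[OF refl])
      (simp add: rk_stage_eq_polynomial[OF L u _ l] t_def y_def sum_distrib_left mult_ac del: funpow.simps)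
  also have "\<dots> = (\<Sum>r<s. \<Sum>i<s. t ^ r * y (Suc r) $ l * (b $ i * elementary_weight A r i))"
    by (rule sum.swap)
  also have "\<dots> = (\<Sum>r<s. stability_coeff b A (Suc r) * t ^ r * y (Suc r) $ l)"
    by (simp add: stability_coeff_def b sum_distrib_left mult_ac)
  finally have "t * (\<Sum>i<s. b $ i * rk_stage A L \<tau> u i $ l)
      = (\<Sum>r<s. stability_coeff b A (Suc r) * t ^ Suc r * y (Suc r) $ l)"
    by (simp add: sum_distrib_left mult_ac)
  moreover have "rk_step b A L \<tau> u $ l = y 0 $ l + t * (\<Sum>i<s. b $ i * rk_stage A L \<tau> u i $ l)"
    using u l b by (simp add: rk_step_def t_def y_def)
  ultimately show ?thesis
    unfolding sum.atMost_shift
    by (simp add: t_def y_def stability_coeff_def[of _ _ 0] del: funpow.simps(2))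
qed

section \<open>The chain matrix\<close>

definition chain_mat :: "nat \<Rightarrow> complex mat" where
  "chain_mat m = mat (Suc m) (Suc m) (\<lambda>(i, j).
     if i = 0 \<and> j = 0 then - 1 / 2 else if j = Suc i then 1 else if i = Suc j then - 1 else 0)"

lemma chain_mat_carrier [simp]: "chain_mat m \<in> carrier_mat (Suc m) (Suc m)"
  by (simp add: chain_mat_def)

lemmas chain_mat_dims [simp] =
  chain_mat_carrier[THEN carrier_matD(1)] chain_mat_carrier[THEN carrier_matD(2)]

lemma chain_mat_mult_vec_nth:
  assumes "x \<in> carrier_vec (Suc m)" and "i \<le> m"
  shows "(chain_mat m *\<^sub>v x) $ i
    = (if i = 0 then - x $ 0 / 2 else - x $ (i - 1)) + (if i < m then x $ Suc i else 0)"
proof -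
  have entry: "chain_mat m $$ (i, k) = (if k = i - 1 then if i = 0 then - 1 / 2 else - 1 else 0)
      + (if k = Suc i then 1 else 0)" if "k < Suc m" for k
    using that assms(2) by (auto simp: chain_mat_def)
  have "(chain_mat m *\<^sub>v x) $ i = (\<Sum>k<Suc m. chain_mat m $$ (i, k) * x $ k)"
    using assms by (simp add: chain_mat_def scalar_prod_def lessThan_atLeast0
        del: sum.op_ivl_Suc sum.lessThan_Suc)
  also have "\<dots> = (\<Sum>k<Suc m. (if k = i - 1 then (if i = 0 then - 1 / 2 else - 1) * x $ k else 0))
      + (\<Sum>k<Suc m. (if k = Suc i then x $ k else 0))"
    unfolding sum.distrib[symmetric] by (rule sum.cong[OF refl]) (auto simp: entry algebra_simps)
  finally show ?thesis using assms(2) by (simp del: sum.lessThan_Suc)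
qed

text \<open>
  Real initial data stay real, so the real operator carries all the analysis.
\<close>

lemma chain_mat_power_of_real:
  "(((*\<^sub>v) (chain_mat m)) ^^ j) (vec (Suc m) (\<lambda>i. of_real (x i)))
     = vec (Suc m) (\<lambda>i. of_real ((chain_op m 1 ^^ j) x i))"
proof (induction j)
  case (Suc j)
  have "chain_mat m *\<^sub>v vec (Suc m) (\<lambda>i. of_real (y i))
      = vec (Suc m) (\<lambda>i. of_real (chain_op m 1 y i))" for y
  proof (rule eq_vecI)
    fix i assume "i < dim_vec (vec (Suc m) (\<lambda>i. complex_of_real (chain_op m 1 y i)))"
    then have "i \<le> m" by simp
    then show "(chain_mat m *\<^sub>v vec (Suc m) (\<lambda>i. of_real (y i))) $ i
        = vec (Suc m) (\<lambda>i. of_real (chain_op m 1 y i)) $ i"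
      by (subst chain_mat_mult_vec_nth) (auto simp: chain_op_def)
  qed (simp add: chain_mat_def)
  then show ?case using Suc by simp
qed simp

lemma mat_adjoint_index:
  "A \<in> carrier_mat n n \<Longrightarrow> i < n \<Longrightarrow> j < n \<Longrightarrow> mat_adjoint A $$ (i, j) = cnj (A $$ (j, i))"
  by (auto simp: mat_adjoint_def mat_of_rows_def)

lemma mat_adjoint_carrier: "A \<in> carrier_mat n n \<Longrightarrow> mat_adjoint A \<in> carrier_mat n n"
  by (auto simp: mat_adjoint_def mat_of_rows_def)

lemma hermitian_matI:
  assumes "A \<in> carrier_mat n n" and "\<And>i j. i < n \<Longrightarrow> j < n \<Longrightarrow> cnj (A $$ (j, i)) = A $$ (i, j)"
  shows "hermitian_mat A"
  unfolding hermitian_mat_def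
proof
  show "mat_adjoint A = A"
    using assms mat_adjoint_carrier[OF assms(1)]
    by (intro eq_matI) (auto simp: mat_adjoint_index[OF assms(1)])
qed (use assms in auto)

lemma Re_cscalar_prod_self: "v \<in> carrier_vec n \<Longrightarrow> Re (v \<bullet>c v) = (\<Sum>i<n. (cmod (v $ i))\<^sup>2)"
  by (auto simp: scalar_prod_def lessThan_atLeast0 Re_sum simp flip: complex_norm_square intro!: sum.cong)

lemma pos_def_hermitian_one: "pos_def_hermitian (1\<^sub>m n)"
  unfolding pos_def_hermitian_def
proof (intro conjI ballI impI)
  show "hermitian_mat (1\<^sub>m n)" by (rule hermitian_matI[of _ n]) auto
  fix v :: "complex vec"
  assume "v \<in> carrier_vec (dim_row (1\<^sub>m n :: complex mat))" and "v \<noteq> 0\<^sub>v (dim_row (1\<^sub>m n :: complex mat))"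
  then have v: "v \<in> carrier_vec n" and "v \<noteq> 0\<^sub>v n" by auto
  then obtain i where "i < n" "v $ i \<noteq> 0" by (metis carrier_vecD eq_vecI index_zero_vec)
  then have "0 < (\<Sum>i<n. (cmod (v $ i))\<^sup>2)" by (intro sum_pos2[of _ i]) auto
  then show "0 < Re ((1\<^sub>m n *\<^sub>v v) \<bullet>c v)" using v Re_cscalar_prod_self[OF v] by simp
qed

lemma weighted_norm_one_of_real:
  "weighted_norm (1\<^sub>m (Suc m)) (vec (Suc m) (\<lambda>i. of_real (x i))) = sqrt (\<Sum>i\<le>m. (x i)\<^sup>2)"
proof -
  let ?v = "vec (Suc m) (\<lambda>i. complex_of_real (x i))"
  have "Re (?v \<bullet>c ?v) = (\<Sum>i\<le>m. (x i)\<^sup>2)"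
    by (subst Re_cscalar_prod_self[of _ "Suc m"]) (auto simp: lessThan_Suc_atMost intro!: sum.cong)
  then show ?thesis by (simp add: weighted_norm_def)
qed

lemma chain_mat_dissipative:
  "neg_semidef_hermitian (mat_adjoint (chain_mat m) * 1\<^sub>m (Suc m) + 1\<^sub>m (Suc m) * chain_mat m)"
proof -
  define D :: "complex mat" where "D = mat (Suc m) (Suc m) (\<lambda>(i, j). if i = 0 \<and> j = 0 then - 1 else 0)"
  have "mat_adjoint (chain_mat m) * 1\<^sub>m (Suc m) + 1\<^sub>m (Suc m) * chain_mat m
      = mat_adjoint (chain_mat m) + chain_mat m"
    using mat_adjoint_carrier[OF chain_mat_carrier[of m]] left_mult_one_mat[OF chain_mat_carrier] by simp
  also have "\<dots> = D"
    using mat_adjoint_carrier[OF chain_mat_carrier[of m]]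
    by (intro eq_matI) (auto simp: mat_adjoint_index[OF chain_mat_carrier] D_def, auto simp: chain_mat_def)
  finally have eq: "mat_adjoint (chain_mat m) * 1\<^sub>m (Suc m) + 1\<^sub>m (Suc m) * chain_mat m = D" .
  have "Re ((D *\<^sub>v v) \<bullet>c v) \<le> 0" if v: "v \<in> carrier_vec (Suc m)" for v
  proof -
    have Dv: "(D *\<^sub>v v) $ i = (if i = 0 then - v $ 0 else 0)" if "i < Suc m" for i
    proof -
      have "(D *\<^sub>v v) $ i = (\<Sum>k<Suc m. (if i = 0 \<and> k = 0 then - 1 else 0) * v $ k)"
        using that v unfolding D_def
        by (simp add: scalar_prod_def lessThan_atLeast0 del: sum.op_ivl_Suc sum.lessThan_Suc)
      then show ?thesis unfolding sum.lessThan_Suc_shift by simp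
    qed
    have "(D *\<^sub>v v) \<bullet>c v = (\<Sum>k<Suc m. (D *\<^sub>v v) $ k * cnj (v $ k))"
      using v by (simp add: scalar_prod_def lessThan_atLeast0
          del: index_mult_mat_vec sum.op_ivl_Suc sum.lessThan_Suc)
    also have "\<dots> = (\<Sum>k<Suc m. (if k = 0 then - v $ 0 else 0) * cnj (v $ k))"
      by (rule sum.cong[OF refl]) (simp add: Dv del: index_mult_mat_vec)
    also have "\<dots> = - v $ 0 * cnj (v $ 0)" unfolding sum.lessThan_Suc_shift by simp
    finally show ?thesis by simp
  qed
  moreover have "hermitian_mat D" by (rule hermitian_matI[of _ "Suc m"]) (auto simp: D_def)
  ultimately show ?thesis unfolding eq neg_semidef_hermitian_def by (simp add: D_def)
qed

text \<open>
  By the energy identity, an eigenvector with \<open>Re e \<ge> 0\<close> would vanish in component \<open>0\<close>; the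
  rows of the eigenvalue equation then make it vanish everywhere. Hence no eigenvalue lies on
  the imaginary axis.
\<close>

lemma eigenvalue_chain_mat_Re_neg:
  assumes "eigenvalue (chain_mat m) e"
  shows "Re e < 0"
proof -
  from assms obtain v where v: "v \<in> carrier_vec (Suc m)" "v \<noteq> 0\<^sub>v (Suc m)"
    and ev: "chain_mat m *\<^sub>v v = e \<cdot>\<^sub>v v"
    unfolding eigenvalue_def eigenvector_def by (auto simp: chain_mat_def)
  \<comment> \<open>The energy identity is stated for real vectors and is applied to real and imaginary part.\<close>
  define x y where "x i = Re (v $ i)" and "y i = Im (v $ i)" for i
  have row: "e * v $ i = (if i = 0 then - v $ 0 / 2 else - v $ (i - 1)) + (if i < m then v $ Suc i else 0)"
    if "i \<le> m" for i
    using chain_mat_mult_vec_nth[OF v(1) that] v(1) that by (simp add: ev)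
  have parts: "chain_op m 1 x i = Re e * x i - Im e * y i \<and> chain_op m 1 y i = Re e * y i + Im e * x i"
    if "i \<le> m" for i
    using arg_cong[OF row[OF that], of Re] arg_cong[OF row[OF that], of Im]
    by (simp add: chain_op_def x_def y_def if_distrib[where f=Re] if_distrib[where f=Im] cong: if_cong)
  have "2 * Re e * (\<Sum>i\<le>m. (x i)\<^sup>2 + (y i)\<^sup>2)
      = (\<Sum>i\<le>m. x i * chain_op m 1 x i + x i * chain_op m 1 x i)
        + (\<Sum>i\<le>m. y i * chain_op m 1 y i + y i * chain_op m 1 y i)"
    unfolding sum.distrib[symmetric] sum_distrib_left
    by (rule sum.cong[OF refl]) (simp add: parts power2_eq_square algebra_simps)
  also have "\<dots> = - ((x 0)\<^sup>2 + (y 0)\<^sup>2)"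
    using chain_op_polar_energy[of 1 m x x] chain_op_polar_energy[of 1 m y y]
    by (simp add: power2_eq_square)
  finally have energy: "2 * Re e * (\<Sum>i\<le>m. (x i)\<^sup>2 + (y i)\<^sup>2) = - ((x 0)\<^sup>2 + (y 0)\<^sup>2)" .
  have "v $ 0 \<noteq> 0"
  proof
    assume v0: "v $ 0 = 0"
    have "i \<le> m \<Longrightarrow> v $ i = 0" for i
    proof (induction i rule: less_induct)
      case (less i)
      show ?case
      proof (cases i)
        case (Suc k)
        have "v $ k = 0" "v $ (k - 1) = 0" using less Suc by auto
        then show ?thesis using row[of k] less.prems Suc v0 by (auto split: if_splits)
      qed (simp add: v0)
    qed
    then have "v = 0\<^sub>v (Suc m)" using v(1) by (intro eq_vecI) auto
    then show False using v(2) by simp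
  qed
  then have "0 < (x 0)\<^sup>2 + (y 0)\<^sup>2" by (simp add: x_def y_def complex_eq_iff sum_power2_gt_zero_iff)
  moreover have "0 \<le> (\<Sum>i\<le>m. (x i)\<^sup>2 + (y i)\<^sup>2)" by (intro sum_nonneg) auto
  ultimately show ?thesis
    using energy mult_nonneg_nonneg[of "2 * Re e" "\<Sum>i\<le>m. (x i)\<^sup>2 + (y i)\<^sup>2"] by linarith
qed

lemma lyapunov_stable_chain_mat: "lyapunov_stable (chain_mat m)"
  using eigenvalue_chain_mat_Re_neg by (fastforce simp: lyapunov_stable_def)

section \<open>Failure of strong stability\<close>

lemma rk_step_chain_mat:
  assumes "explicit_rk (2 * m) b A" and "rk_order b A (2 * m)"
  shows "rk_step b A (chain_mat m) h (vec (Suc m) (\<lambda>i. of_real (h ^ (m - i) * v i)))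
    = vec (Suc m) (\<lambda>i. of_real (h ^ (m - i) * trunc_exp m v h 1 i))" (is "rk_step b A _ h ?u = _")
proof (rule eq_vecI)
  fix i assume "i < dim_vec (vec (Suc m) (\<lambda>i. complex_of_real (h ^ (m - i) * trunc_exp m v h 1 i)))"
  then have i: "i < Suc m" by simp
  let ?T = "\<lambda>j. (chain_op m 1 ^^ j) (\<lambda>i. h ^ (m - i) * v i) i"
  have "rk_step b A (chain_mat m) h ?u $ i
      = (\<Sum>j\<le>2 * m. stability_coeff b A j * of_real h ^ j * (((*\<^sub>v) (chain_mat m)) ^^ j) ?u $ i)"
    by (rule rk_step_eq_polynomial[OF assms(1)]) (use i in auto)
  also have "\<dots> = of_real (\<Sum>j\<le>2 * m. 1 / fact j * (h ^ j * ?T j))"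
    unfolding chain_mat_power_of_real of_real_sum
    by (intro sum.cong refl) (use i in \<open>simp add: stability_coeff_of_order[OF assms]\<close>)
  also have "(\<Sum>j\<le>2 * m. 1 / fact j * (h ^ j * ?T j)) = h ^ (m - i) * trunc_exp m v h 1 i"
    using i by (simp add: chain_op_power_rescale trunc_exp_def sum_distrib_left)
  finally show "rk_step b A (chain_mat m) h ?u $ i
      = vec (Suc m) (\<lambda>i. of_real (h ^ (m - i) * trunc_exp m v h 1 i)) $ i" using i by simp
qed (simp add: rk_step_def)

lemma weighted_norm_scaled:
  "weighted_norm (1\<^sub>m (Suc m)) (vec (Suc m) (\<lambda>i. of_real (h ^ (m - i) * trunc_exp m v h s i)))
     = sqrt (energy m v h s)"
  unfolding weighted_norm_one_of_real energy_def
  by (simp add: power_mult_distrib flip: power_mult mult.commute[of 2])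

lemma trunc_exp_0: "trunc_exp m v h 0 i = v i"
  unfolding trunc_exp_def sum.atMost_shift by simp

theorem theorem2:
  fixes p s :: nat and b :: "complex vec" and A :: "complex mat"
  assumes "p \<in> {4 * m | m. 1 \<le> m}"
    and "explicit_rk s b A"
    and "s = p"
    and "rk_order b A p"
  shows "\<not> strongly_stable b A"
proof
  assume stable: "strongly_stable b A"
  from assms(1) obtain k where p: "p = 4 * k" and k: "0 < k" by auto
  define m where "m = 2 * k"
  have rk: "explicit_rk (2 * m) b A" "rk_order b A (2 * m)" using assms p by (auto simp: m_def)
  obtain v \<delta> where "0 < \<delta>"
    and growth: "\<And>h. 0 < h \<Longrightarrow> h < \<delta> \<Longrightarrow> energy m v h 0 < energy m v h 1"
    using energy_growth[OF m_def k] by blast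
  let ?I = "1\<^sub>m (Suc m)"
  obtain \<epsilon> where "0 < \<epsilon>" and contract: "\<And>\<tau> u. 0 < \<tau> \<Longrightarrow> \<tau> < \<epsilon> \<Longrightarrow> u \<in> carrier_vec (Suc m) \<Longrightarrow>
      weighted_norm ?I (rk_step b A (chain_mat m) \<tau> u) \<le> weighted_norm ?I u"
    using stable[unfolded strongly_stable_def, rule_format, of "Suc m" "chain_mat m" ?I]
      lyapunov_stable_chain_mat[of m] pos_def_hermitian_one[of "Suc m"] chain_mat_dissipative[of m]
    by auto
  define h where "h = min \<delta> \<epsilon> / 2"
  have h: "0 < h" "h < \<delta>" "h < \<epsilon>" using \<open>0 < \<delta>\<close> \<open>0 < \<epsilon>\<close> by (auto simp: h_def)
  let ?u = "vec (Suc m) (\<lambda>i. complex_of_real (h ^ (m - i) * v i))"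
  have "weighted_norm ?I (rk_step b A (chain_mat m) h ?u) \<le> weighted_norm ?I ?u"
    by (rule contract) (use h in auto)
  then have "sqrt (energy m v h 1) \<le> sqrt (energy m v h 0)"
    unfolding rk_step_chain_mat[OF rk] weighted_norm_scaled
    using weighted_norm_scaled[of m h v 0] by (simp add: trunc_exp_0)
  then show False using growth[OF h(1,2)] by simp
qed

end
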